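(* The equation $(x+1)\,x^{-1/(x+1)}=e$ has a unique solution $x$ with $0<x<1$; denote it by $A$. For every real number $a$ with $A<a\le e$, any infinite sequence $\varepsilon$ of signs $+,-$ represents an element of $\overline{\mathbb{R}}$ and any element of $\overline{\mathbb{R}}$ is representable; that is, $a$ is suitable. In particular, $a=1$ is suitable.
   Context: $\overline{\mathbb{R}}=[-\infty,+\infty]$ is the extended real line with its usual order topology; convergence is in $\overline{\mathbb{R}}$ (infinite limits allowed). For a fixed real $a>0$ define $f_+,f_-:\overline{\mathbb{R}}\to\overline{\mathbb{R}}$ by $f_+(x)=e^{ax}$ and $f_-(x)=-e^{ax}$, with $e^{-\infty}=0$, $e^{+\infty}=+\infty$. For an infinite sequence $\varepsilon=(\varepsilon_1,\varepsilon_2,\ldots)$ of signs $+$ and $-$ and $n\ge 0$, put $f_{n,\varepsilon}=f_{\varepsilon_1}\circ f_{\varepsilon_2}\circ\cdots\circ f_{\varepsilon_n}$ ($f_{0,\varepsilon}$ is the identity) and $u_{n,\varepsilon}=f_{n,\varepsilon}(1)$. The sequence $\varepsilon$ represents $t\in\overline{\mathbb{R}}$ if $u_{n,\varepsilon}\to t$ in $\overline{\mathbb{R}}$ as $n\to\infty$; $t\in\overline{\mathbb{R}}$ is representable if some $\varepsilon$ represents it. The number $a$ is suitable if every infinite sequence $\varepsilon$ represents an element of $\overline{\mathbb{R}}$ and every element of $\overline{\mathbb{R}}$ is representable. *)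

theory Defs
  imports "HOL-Analysis.Analysis"
begin

function ereal_exp :: "ereal \<Rightarrow> ereal" where
  "ereal_exp (ereal r) = ereal (exp r)"
| "ereal_exp \<infinity> = \<infinity>"
| "ereal_exp (- \<infinity>) = 0"
  by (auto intro: ereal_cases)
termination by (relation "{}") auto

datatype sign = PlusSign | MinusSign

text \<open>For \<open>a > 0\<close>, multiplication by \<open>ereal a\<close> fixes both infinities, so
  \<open>sign_fun a\<close> takes the limit values of \<open>exp (a * x)\<close> and \<open>- exp (a * x)\<close> there.\<close>

definition sign_fun :: "real \<Rightarrow> sign \<Rightarrow> ereal \<Rightarrow> ereal" where
  "sign_fun a s x =
    (case s of PlusSign \<Rightarrow> ereal_exp (ereal a * x) | MinusSign \<Rightarrow> - ereal_exp (ereal a * x))"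

text \<open>Sign sequences are indexed from 0: the sign written \<open>\<epsilon>\<^sub>k\<close> in the usual
  1-based notation is \<open>\<epsilon> (k - 1)\<close>. Later signs are applied first (innermost).\<close>

primrec sign_comp :: "real \<Rightarrow> (nat \<Rightarrow> sign) \<Rightarrow> nat \<Rightarrow> ereal \<Rightarrow> ereal" where
  "sign_comp a \<epsilon> 0 = id"
| "sign_comp a \<epsilon> (Suc n) = sign_comp a \<epsilon> n \<circ> sign_fun a (\<epsilon> n)"

definition sign_iter :: "real \<Rightarrow> (nat \<Rightarrow> sign) \<Rightarrow> nat \<Rightarrow> ereal" where
  "sign_iter a \<epsilon> n = sign_comp a \<epsilon> n 1"

definition represents :: "real \<Rightarrow> (nat \<Rightarrow> sign) \<Rightarrow> ereal \<Rightarrow> bool" where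
  "represents a \<epsilon> t \<longleftrightarrow> sign_iter a \<epsilon> \<longlonglongrightarrow> t"

definition representable :: "real \<Rightarrow> ereal \<Rightarrow> bool" where
  "representable a t \<longleftrightarrow> (\<exists>\<epsilon>. represents a \<epsilon> t)"

definition suitable :: "real \<Rightarrow> bool" where
  "suitable a \<longleftrightarrow> a > 0 \<and> (\<forall>\<epsilon>. \<exists>t. represents a \<epsilon> t) \<and> (\<forall>t. representable a t)"

definition is_threshold :: "real \<Rightarrow> bool" where
  "is_threshold x \<longleftrightarrow> 0 < x \<and> x < 1 \<and> (x + 1) * x powr (- 1 / (x + 1)) = exp 1"

text \<open>Meaningful only together with \<open>\<exists>!x. is_threshold x\<close>.\<close>

definition threshold :: real where
  "threshold = (THE x. is_threshold x)"

end

(*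
  Let rho > 0 be an integrable density on the real line and Phi its primitive, extended to the
  infinities. If  a * exp (a * x) * rho (+- exp (a * x)) < rho x  for all but finitely many x, then
  both sign functions strictly decrease the distance |Phi x - Phi y| on the extended real line.
  This space is compact, so distances of at least eta shrink by a uniform factor < 1 and the images
  of the whole line under n-fold compositions shrink to points, uniformly in the sign sequence.
  Hence every sequence converges; and every t is representable because the images of the two sign
  functions cover the line, so that preimages of t can be chosen one after the other.

  For 1 <= a <= e the density 1/(1 + a|x|) on [-1, 1] works, continued by 1/(a x^2) to the right and
  by a e^(a x) to the left; for a = e equality occurs at x = -1/e, the neutral fixed
  point of x |-> -e^(e x). For a < 1 one uses K a e^(a x) on the negative reals, 1 on [0, 1/a] and
  (a x)^(-1 - 1/a) beyond; this needs a w^(1 + 1/a) < e^w for all w > 0, and the maximum over w is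
  governed by the threshold equation.
*)
theory Submission
  imports Defs "HOL-Real_Asymp.Real_Asymp"
begin

subsection \<open>Strict contractions of the extended real line\<close>

text \<open>The quotient of the distances after and before \<open>f\<close> is continuous on the
  compact set of pairs at distance at least \<open>\<eta>\<close>, so it attains its maximum there,
  and this is below 1. Near the diagonal the quotient may approach 1, whence the cutoff
  \<open>\<eta>\<close>.\<close>

lemma strict_contraction_uniform:
  fixes \<Phi> :: "'a::topological_space \<Rightarrow> real" and f :: "'a \<Rightarrow> 'a"
  assumes "compact (UNIV :: 'a set)"
    and \<Phi>: "continuous_on UNIV \<Phi>" and f: "continuous_on UNIV f"
    and contr: "\<And>x y. x \<noteq> y \<Longrightarrow> \<bar>\<Phi> (f x) - \<Phi> (f y)\<bar> < \<bar>\<Phi> x - \<Phi> y\<bar>"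
    and "0 < \<eta>"
  shows "\<exists>l. 0 \<le> l \<and> l < 1 \<and>
    (\<forall>x y. \<eta> \<le> \<bar>\<Phi> x - \<Phi> y\<bar> \<longrightarrow> \<bar>\<Phi> (f x) - \<Phi> (f y)\<bar> \<le> l * \<bar>\<Phi> x - \<Phi> y\<bar>)"
proof -
  define d where "d z = \<bar>\<Phi> (fst z) - \<Phi> (snd z)\<bar>" for z
  define d' where "d' z = \<bar>\<Phi> (f (fst z)) - \<Phi> (f (snd z))\<bar>" for z
  define C where "C = {z. \<eta> \<le> d z}"
  have c\<Phi>: "continuous_on UNIV (\<lambda>z. \<Phi> (g z))" if "continuous_on UNIV g" for g :: "'a \<times> 'a \<Rightarrow> 'a"
    by (rule continuous_on_compose2[OF \<Phi> that]) auto
  have cf: "continuous_on UNIV (\<lambda>z. f (g z))" if "continuous_on UNIV g" for g :: "'a \<times> 'a \<Rightarrow> 'a"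
    by (rule continuous_on_compose2[OF f that]) auto
  have fst_snd: "continuous_on UNIV (fst :: 'a \<times> 'a \<Rightarrow> 'a)" "continuous_on UNIV (snd :: 'a \<times> 'a \<Rightarrow> 'a)"
    by (auto intro: continuous_intros)
  have d: "continuous_on UNIV d" unfolding d_def
    by (intro continuous_intros c\<Phi> fst_snd)
  have d': "continuous_on UNIV d'" unfolding d'_def
    by (intro continuous_intros c\<Phi> cf fst_snd)
  have "closed C" unfolding C_def
    using d by (intro closed_Collect_le) (auto intro: continuous_intros)
  moreover have "compact (UNIV :: ('a \<times> 'a) set)"
    using compact_Times[OF assms(1) assms(1)] by simp
  ultimately have C: "compact C"
    using closed_Int_compact[of C UNIV] by simp
  show ?thesis
  proof (cases "C = {}")
    case True
    then show ?thesis by (intro exI[of _ 0]) (auto simp: C_def d_def)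
  next
    case False
    have "continuous_on C (\<lambda>z. d' z / d z)"
      using \<open>0 < \<eta>\<close>
      by (intro continuous_intros continuous_on_subset[OF d] continuous_on_subset[OF d'])
        (auto simp: C_def)
    from continuous_attains_sup[OF C False this]
    obtain w where w: "w \<in> C" "\<And>z. z \<in> C \<Longrightarrow> d' z / d z \<le> d' w / d w" by auto
    have pos: "d z > 0" if "z \<in> C" for z using that \<open>0 < \<eta>\<close> by (auto simp: C_def)
    have "fst w \<noteq> snd w" using pos[OF w(1)] by (auto simp: d_def)
    then have "d' w < d w" using contr by (simp add: d_def d'_def)
    then have "d' w / d w < 1" using pos[OF w(1)] by simp
    moreover have "0 \<le> d' w / d w" by (simp add: d_def d'_def)
    moreover have le: "d' z \<le> d' w / d w * d z" if "z \<in> C" for z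
      using w(2)[OF that] pos[OF that] by (simp add: pos_divide_le_eq)
    then have "\<bar>\<Phi> (f x) - \<Phi> (f y)\<bar> \<le> d' w / d w * \<bar>\<Phi> x - \<Phi> y\<bar>"
      if "\<eta> \<le> \<bar>\<Phi> x - \<Phi> y\<bar>" for x y
      using that le[of "(x, y)"] unfolding C_def d_def d'_def by simp
    ultimately show ?thesis by blast
  qed
qed

text \<open>Distances of at least \<open>\<eta>\<close> shrink by a fixed factor and smaller ones do
  not grow, so \<open>n\<close> steps leave at most \<open>max \<eta> (m ^ n * d x y)\<close>. The
  initial distance is bounded because \<open>\<Phi>\<close> has compact range.\<close>

lemma sign_comp_shrinks:
  fixes \<Phi> :: "ereal \<Rightarrow> real"
  assumes \<Phi>: "continuous_on UNIV \<Phi>"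
    and f: "\<And>s. continuous_on UNIV (sign_fun a s)"
    and contr: "\<And>s x y. x \<noteq> y \<Longrightarrow> \<bar>\<Phi> (sign_fun a s x) - \<Phi> (sign_fun a s y)\<bar> < \<bar>\<Phi> x - \<Phi> y\<bar>"
    and "0 < \<eta>"
  shows "\<exists>N. \<forall>n\<ge>N. \<forall>\<epsilon> x y. \<bar>\<Phi> (sign_comp a \<epsilon> n x) - \<Phi> (sign_comp a \<epsilon> n y)\<bar> \<le> \<eta>"
proof -
  define d where "d x y = \<bar>\<Phi> x - \<Phi> y\<bar>" for x y
  have "\<exists>l. 0 \<le> l \<and> l < 1 \<and> (\<forall>x y. \<eta> \<le> d x y \<longrightarrow>
      d (sign_fun a s x) (sign_fun a s y) \<le> l * d x y)" for s
    unfolding d_def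
    using strict_contraction_uniform[of \<Phi> "sign_fun a s" \<eta>] compact_UNIV \<Phi> f contr \<open>0 < \<eta>\<close>
    by blast
  then have "\<exists>l. \<forall>s. 0 \<le> l s \<and> l s < 1 \<and> (\<forall>x y. \<eta> \<le> d x y \<longrightarrow>
      d (sign_fun a s x) (sign_fun a s y) \<le> l s * d x y)"
    by (intro choice allI)
  then obtain l where l: "0 \<le> l s" "l s < 1"
      "\<And>x y. \<eta> \<le> d x y \<Longrightarrow> d (sign_fun a s x) (sign_fun a s y) \<le> l s * d x y" for s
    by blast
  \<comment> \<open>There are only two sign functions, so the larger of their factors serves every
    sign sequence.\<close>
  define m where "m = max (l PlusSign) (l MinusSign)"
  have m: "0 \<le> m" "m < 1" using l by (auto simp: m_def le_max_iff_disj)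
  have lm: "l s \<le> m" for s by (cases s) (auto simp: m_def)
  have d0: "0 \<le> d x y" for x y by (simp add: d_def)
  have step: "d (sign_fun a s x) (sign_fun a s y) \<le> max \<eta> (m * d x y)" for s x y
  proof (cases "\<eta> \<le> d x y")
    case True
    have "d (sign_fun a s x) (sign_fun a s y) \<le> l s * d x y" by (rule l(3)[OF True])
    also have "\<dots> \<le> m * d x y" by (rule mult_right_mono[OF lm d0])
    finally show ?thesis by simp
  next
    case False
    have "d (sign_fun a s x) (sign_fun a s y) \<le> d x y"
      using contr[of x y s] by (cases "x = y") (auto simp: d_def)
    with False show ?thesis by simp
  qed
  \<comment> \<open>The newest sign is applied first, so the induction hypothesis is needed at the
    images of \<open>x\<close> and \<open>y\<close> under it.\<close>
  have iter: "d (sign_comp a \<epsilon> n x) (sign_comp a \<epsilon> n y) \<le> max \<eta> (m ^ n * d x y)" for \<epsilon> n x y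
  proof (induction n arbitrary: x y)
    case (Suc n)
    let ?x = "sign_fun a (\<epsilon> n) x" and ?y = "sign_fun a (\<epsilon> n) y"
    have mn: "0 \<le> m ^ n" "m ^ n \<le> 1" using m by (auto intro: power_le_one)
    have "m ^ n * d ?x ?y \<le> m ^ n * max \<eta> (m * d x y)"
      by (rule mult_left_mono[OF step mn(1)])
    also have "\<dots> = max (m ^ n * \<eta>) (m ^ Suc n * d x y)"
      using mn by (simp add: max_mult_distrib_left mult_ac)
    also have "\<dots> \<le> max \<eta> (m ^ Suc n * d x y)"
      using mn \<open>0 < \<eta>\<close> mult_right_mono[of "m ^ n" 1 \<eta>] by (intro max.mono) auto
    finally show ?case using Suc[of ?x ?y] by simp
  qed simp
  have "bounded (range \<Phi>)"
    by (intro compact_imp_bounded compact_continuous_image \<Phi> compact_UNIV)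
  then obtain B where "B > 0" and B: "\<And>x. \<bar>\<Phi> x\<bar> \<le> B" unfolding bounded_pos by auto
  have dB: "d x y \<le> 2 * B" for x y using B[of x] B[of y] by (auto simp: d_def)
  have "(\<lambda>n. m ^ n * (2 * B)) \<longlonglongrightarrow> 0 * (2 * B)"
    using m by (intro tendsto_mult LIMSEQ_power_zero tendsto_const) auto
  then have "eventually (\<lambda>n. m ^ n * (2 * B) < \<eta>) sequentially"
    using \<open>0 < \<eta>\<close> by (intro order_tendstoD(2)) auto
  then obtain N where N: "\<And>n. n \<ge> N \<Longrightarrow> m ^ n * (2 * B) < \<eta>"
    unfolding eventually_sequentially by auto
  have "d (sign_comp a \<epsilon> n x) (sign_comp a \<epsilon> n y) \<le> \<eta>" if "n \<ge> N" for n \<epsilon> x y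
  proof -
    have "m ^ n * d x y \<le> m ^ n * (2 * B)"
      by (intro mult_left_mono dB) (use m in auto)
    then show ?thesis using iter[of \<epsilon> n x y] N[OF that] by linarith
  qed
  then show ?thesis unfolding d_def by blast
qed

text \<open>Allows limits to be taken after applying \<open>\<Phi>\<close>: order neighbourhoods of
  \<open>t\<close> are cut out by points \<open>c\<close>, and a strictly monotone map reflects
  comparisons with \<open>c\<close>.\<close>

lemma tendsto_of_strict_mono:
  fixes \<Phi> :: "'a::linorder_topology \<Rightarrow> 'b::linorder_topology"
  assumes "strict_mono \<Phi>" "((\<lambda>n. \<Phi> (u n)) \<longlongrightarrow> \<Phi> t) F"
  shows "(u \<longlongrightarrow> t) F"
proof (rule order_tendstoI)
  fix c assume "c < t"
  then have "\<forall>\<^sub>F n in F. \<Phi> c < \<Phi> (u n)"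
    using assms by (intro order_tendstoD(1)[OF assms(2)]) (auto dest: strict_monoD)
  then show "\<forall>\<^sub>F n in F. c < u n"
    by eventually_elim (simp add: strict_mono_less[OF assms(1)])
next
  fix c assume "t < c"
  then have "\<forall>\<^sub>F n in F. \<Phi> (u n) < \<Phi> c"
    using assms by (intro order_tendstoD(2)[OF assms(2)]) (auto dest: strict_monoD)
  then show "\<forall>\<^sub>F n in F. u n < c"
    by eventually_elim (simp add: strict_mono_less[OF assms(1)])
qed

text \<open>Exhibits every later iterate as a value of the \<open>n\<close>-fold composition, so
  that a small image of the latter controls the whole tail.\<close>

lemma sign_comp_add:
  "sign_comp a \<epsilon> (n + m) x = sign_comp a \<epsilon> n (sign_comp a (\<lambda>k. \<epsilon> (n + k)) m x)"
  by (induction m arbitrary: x) auto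

text \<open>The plus function takes all values from 0 to \<open>\<infinity>\<close>, with 0 attained
  at \<open>-\<infinity>\<close>, and the minus function takes their negatives.\<close>

lemma sign_fun_surj:
  assumes "a > 0"
  shows "\<exists>s y. sign_fun a s y = t"
proof -
  have pos: "\<exists>y. ereal_exp (ereal a * y) = t" if "t \<ge> 0" for t
  proof (cases t)
    case (real r)
    show ?thesis
    proof (cases "r = 0")
      case True
      then have "ereal_exp (ereal a * (-\<infinity>)) = t" using real assms by (simp add: zero_ereal_def)
      then show ?thesis by blast
    next
      case False
      then have "ereal_exp (ereal a * ereal (ln r / a)) = t" using real that assms by simp
      then show ?thesis by blast
    qed
  next
    case PInf
    then have "ereal_exp (ereal a * \<infinity>) = t" using assms by simp
    then show ?thesis by blast
  qed (use that in auto)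
  show ?thesis
  proof (cases "t \<ge> 0")
    case True
    with pos obtain y where "ereal_exp (ereal a * y) = t" by blast
    then have "sign_fun a PlusSign y = t" by (simp add: sign_fun_def)
    then show ?thesis by blast
  next
    case False
    then have "- t \<ge> 0" by (simp add: ereal_uminus_le_reorder)
    with pos obtain y where "ereal_exp (ereal a * y) = - t" by blast
    then have "sign_fun a MinusSign y = t" by (simp add: sign_fun_def)
    then show ?thesis by blast
  qed
qed

text \<open>All iterates from index \<open>N\<close> on lie in one image of small
  \<open>\<Phi>\<close>-diameter, and compactness of the range of \<open>\<Phi>\<close> keeps the
  limit inside it. For representability, \<open>t\<close> lies in all these images once the signs
  follow a backward orbit of \<open>t\<close>.\<close>

lemma suitable_of_contraction:
  fixes \<Phi> :: "ereal \<Rightarrow> real"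
  assumes "a > 0" and \<Phi>: "continuous_on UNIV \<Phi>" and mono: "strict_mono \<Phi>"
    and f: "\<And>s. continuous_on UNIV (sign_fun a s)"
    and contr: "\<And>s x y. x \<noteq> y \<Longrightarrow> \<bar>\<Phi> (sign_fun a s x) - \<Phi> (sign_fun a s y)\<bar> < \<bar>\<Phi> x - \<Phi> y\<bar>"
  shows "suitable a"
proof -
  have shrink: "\<exists>N. \<forall>n\<ge>N. \<forall>\<epsilon> x y.
      \<bar>\<Phi> (sign_comp a \<epsilon> n x) - \<Phi> (sign_comp a \<epsilon> n y)\<bar> \<le> \<eta>" if "0 < \<eta>" for \<eta>
    using \<Phi> f contr that by (rule sign_comp_shrinks)
  have "\<exists>t. represents a \<epsilon> t" for \<epsilon>
  proof -
    have "Cauchy (\<lambda>n. \<Phi> (sign_iter a \<epsilon> n))"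
    proof (rule metric_CauchyI)
      fix e :: real assume "0 < e"
      then obtain N where N: "\<And>n \<epsilon> x y. n \<ge> N \<Longrightarrow>
          \<bar>\<Phi> (sign_comp a \<epsilon> n x) - \<Phi> (sign_comp a \<epsilon> n y)\<bar> \<le> e / 3"
        using shrink[of "e / 3"] by (meson divide_pos_pos zero_less_numeral)
      \<comment> \<open>Both terms are values of the same \<open>N\<close>-fold composition, at a
        tail iterate and at 1. Comparing two indices through \<open>N\<close> then costs 2e/3 <
        e.\<close>
      have *: "\<bar>\<Phi> (sign_iter a \<epsilon> m) - \<Phi> (sign_iter a \<epsilon> N)\<bar> \<le> e / 3" if "m \<ge> N" for m
        using N[of N \<epsilon> "sign_comp a (\<lambda>k. \<epsilon> (N + k)) (m - N) 1" 1] that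
          sign_comp_add[of a \<epsilon> N "m - N" 1]
        by (simp add: sign_iter_def)
      have "dist (\<Phi> (sign_iter a \<epsilon> m)) (\<Phi> (sign_iter a \<epsilon> n)) < e" if "m \<ge> N" "n \<ge> N" for m n
        using *[OF that(1)] *[OF that(2)] \<open>0 < e\<close> unfolding dist_real_def by linarith
      then show "\<exists>M. \<forall>m\<ge>M. \<forall>n\<ge>M. dist (\<Phi> (sign_iter a \<epsilon> m)) (\<Phi> (sign_iter a \<epsilon> n)) < e"
        by blast
    qed
    then obtain L where L: "(\<lambda>n. \<Phi> (sign_iter a \<epsilon> n)) \<longlonglongrightarrow> L"
      using Cauchy_convergent convergent_def by blast
    have "closed (range \<Phi>)"
      by (intro compact_imp_closed compact_continuous_image \<Phi> compact_UNIV)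
    then have "L \<in> range \<Phi>" by (rule closed_sequentially[OF _ _ L]) auto
    then obtain t where "L = \<Phi> t" by blast
    with L have "represents a \<epsilon> t"
      unfolding represents_def by (intro tendsto_of_strict_mono[OF mono]) simp
    then show ?thesis ..
  qed
  moreover have "representable a t" for t
  proof -
    from sign_fun_surj[OF \<open>a > 0\<close>] obtain S P
      where SP: "sign_fun a (S x) (P x) = x" for x by metis
    \<comment> \<open>The points \<open>(P ^^ n) t\<close> form a backward orbit of
      \<open>t\<close>, and \<open>\<epsilon> n\<close> is the sign whose function maps point
      \<open>n + 1\<close> to point \<open>n\<close>.\<close>
    define \<epsilon> where "\<epsilon> n = S ((P ^^ n) t)" for n
    have t: "sign_comp a \<epsilon> n ((P ^^ n) t) = t" for n
      by (induction n) (simp_all add: \<epsilon>_def SP)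
    have "(\<lambda>n. \<Phi> (sign_iter a \<epsilon> n)) \<longlonglongrightarrow> \<Phi> t"
    proof (rule metric_LIMSEQ_I)
      fix e :: real assume "0 < e"
      then obtain N where N: "\<And>n \<epsilon> x y. n \<ge> N \<Longrightarrow>
          \<bar>\<Phi> (sign_comp a \<epsilon> n x) - \<Phi> (sign_comp a \<epsilon> n y)\<bar> \<le> e / 2"
        using shrink[of "e / 2"] by (meson divide_pos_pos zero_less_numeral)
      have "dist (\<Phi> (sign_iter a \<epsilon> n)) (\<Phi> t) < e" if "n \<ge> N" for n
        using N[OF that, of \<epsilon> 1 "(P ^^ n) t"] t[of n] \<open>0 < e\<close>
        by (simp add: dist_real_def sign_iter_def)
      then show "\<exists>N. \<forall>n\<ge>N. dist (\<Phi> (sign_iter a \<epsilon> n)) (\<Phi> t) < e" by blast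
    qed
    then show ?thesis
      unfolding representable_def represents_def using tendsto_of_strict_mono[OF mono] by blast
  qed
  ultimately show ?thesis using \<open>a > 0\<close> by (simp add: suitable_def)
qed

section \<open>From densities on the real line to contractions of the extended line\<close>

lemma continuous_on_ereal_extension:
  fixes H :: "ereal \<Rightarrow> 'b::topological_space"
  assumes "continuous_on UNIV h" "(h \<longlongrightarrow> U) at_top" "(h \<longlongrightarrow> L) at_bot"
    and "\<And>r. H (ereal r) = h r" "H \<infinity> = U" "H (-\<infinity>) = L"
  shows "continuous_on UNIV H"
proof -
  have "isCont H x" for x
  proof (cases x)
    case (real r)
    have "isCont h r" using assms(1) by (simp add: continuous_on_eq_continuous_at)
    then show ?thesis
      unfolding real isCont_def unfolding at_ereal filterlim_filtermap assms .
  next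
    case PInf
    \<comment> \<open>Nothing lies above \<open>\<infinity>\<close>, so its punctured neighbourhoods
      are one-sided and come from \<open>at_top\<close> via \<open>ereal\<close>.\<close>
    have "at (\<infinity>::ereal) = at_left \<infinity>"
    proof -
      have "UNIV - {\<infinity>::ereal} = {..<\<infinity>} - {\<infinity>}" by auto
      then show ?thesis unfolding at_within_def by (rule arg_cong)
    qed
    then show ?thesis
      unfolding PInf isCont_def by (simp add: at_left_PInf filterlim_filtermap assms)
  next
    case MInf
    have "at (-\<infinity>::ereal) = at_right (-\<infinity>)"
    proof -
      have "UNIV - {-\<infinity>::ereal} = {-\<infinity><..} - {-\<infinity>}" by auto
      then show ?thesis unfolding at_within_def by (rule arg_cong)
    qed
    then show ?thesis
      unfolding MInf isCont_def by (simp add: at_right_MInf filterlim_filtermap assms)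
  qed
  then show ?thesis by (simp add: continuous_at_imp_continuous_on)
qed

lemma continuous_on_sign_fun:
  assumes "a > 0"
  shows "continuous_on UNIV (sign_fun a s)"
proof -
  have exp: "continuous_on UNIV (\<lambda>x. ereal_exp (ereal a * x))"
  proof (rule continuous_on_ereal_extension)
    show "continuous_on UNIV (\<lambda>r. ereal (exp (a * r)))"
      by (intro continuous_intros)
    have "filterlim (\<lambda>r. exp (a * r)) at_top at_top"
      using assms by (intro filterlim_compose[OF exp_at_top] filterlim_tendsto_pos_mult_at_top[OF tendsto_const])
        (auto intro: filterlim_ident)
    then show "((\<lambda>r. ereal (exp (a * r))) \<longlongrightarrow> \<infinity>) at_top"
      by (simp add: tendsto_PInfty_eq_at_top)
    have "((\<lambda>r. exp (a * r)) \<longlongrightarrow> 0) at_bot"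
      using assms by (intro filterlim_compose[OF exp_at_bot] filterlim_tendsto_pos_mult_at_bot[OF tendsto_const])
        (auto intro: filterlim_ident)
    then show "((\<lambda>r. ereal (exp (a * r))) \<longlongrightarrow> 0) at_bot"
      by (simp add: zero_ereal_def)
  qed (use assms in auto)
  show ?thesis
  proof (cases s)
    case PlusSign
    then show ?thesis using exp by (simp add: sign_fun_def[abs_def])
  next
    case MinusSign
    have "continuous_on UNIV (\<lambda>x. - ereal_exp (ereal a * x))"
      by (rule continuous_on_compose2[OF continuous_uminus_ereal exp]) auto
    then show ?thesis using MinusSign by (simp add: sign_fun_def[abs_def])
  qed
qed

text \<open>Passing to the limit gives only weak inequalities at the infinities; inserting
  \<open>r + 1\<close> or \<open>r - 1\<close> in between makes them strict.\<close>

lemma strict_mono_ereal_extension: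
  fixes G :: "ereal \<Rightarrow> real"
  assumes G: "continuous_on UNIV G" and mono: "strict_mono (\<lambda>r. G (ereal r))"
  shows "strict_mono G"
proof -
  have at: "isCont G x" for x using G by (simp add: continuous_on_eq_continuous_at)
  have top: "G (ereal r) < G \<infinity>" for r
  proof -
    have "(ereal \<longlongrightarrow> \<infinity>) at_top"
      by (simp add: tendsto_PInfty_eq_at_top filterlim_ident)
    then have "((\<lambda>s. G (ereal s)) \<longlongrightarrow> G \<infinity>) at_top"
      by (rule isCont_tendsto_compose[OF at])
    moreover have "\<forall>\<^sub>F s in at_top. G (ereal (r + 1)) \<le> G (ereal s)"
      using eventually_ge_at_top[of "r + 1"]
      by eventually_elim (simp add: strict_mono_less_eq[OF mono])
    ultimately have "G (ereal (r + 1)) \<le> G \<infinity>"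
      by (intro tendsto_lowerbound) auto
    then show ?thesis using strict_monoD[OF mono, of r "r + 1"] by simp
  qed
  have bot: "G (-\<infinity>) < G (ereal r)" for r
  proof -
    have "(ereal \<longlongrightarrow> -\<infinity>) at_bot"
      by (simp add: tendsto_MInfty filterlim_at_bot_dense[symmetric])
    then have "((\<lambda>s. G (ereal s)) \<longlongrightarrow> G (-\<infinity>)) at_bot"
      by (rule isCont_tendsto_compose[OF at])
    moreover have "\<forall>\<^sub>F s in at_bot. G (ereal s) \<le> G (ereal (r - 1))"
      using eventually_le_at_bot[of "r - 1"]
      by eventually_elim (simp add: strict_mono_less_eq[OF mono])
    ultimately have "G (-\<infinity>) \<le> G (ereal (r - 1))"
      by (intro tendsto_upperbound) auto
    then show ?thesis using strict_monoD[OF mono, of "r - 1" r] by simp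
  qed
  show ?thesis
  proof (rule strict_monoI)
    fix x y :: ereal assume "x < y"
    then show "G x < G y"
      using top bot strict_monoD[OF mono] less_trans[OF bot[of 0] top[of 0]]
      by (cases x; cases y; simp)
  qed
qed

text \<open>Induction on the number of exceptional points strictly between \<open>x\<close> and
  \<open>y\<close>, cutting the interval at one of them. Continuity covers the endpoints.\<close>

lemma strict_mono_of_deriv_pos_except_finite:
  fixes g :: "real \<Rightarrow> real"
  assumes "finite S" and cont: "continuous_on UNIV g"
    and der: "\<And>x. x \<notin> S \<Longrightarrow> \<exists>D. (g has_real_derivative D) (at x) \<and> D > 0"
  shows "strict_mono g"
proof (rule strict_monoI)
  fix x y :: real assume "x < y"
  then show "g x < g y"
  proof (induction "card (S \<inter> {x<..<y})" arbitrary: x y rule: less_induct)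
    case less
    show ?case
    proof (cases "S \<inter> {x<..<y} = {}")
      case True
      show ?thesis
      proof (rule DERIV_pos_imp_increasing_open[OF less.prems])
        show "\<exists>D. (g has_real_derivative D) (at z) \<and> D > 0" if "x < z" "z < y" for z
          using True that by (intro der) auto
        show "continuous_on {x..y} g"
          using cont by (rule continuous_on_subset) auto
      qed
    next
      case False
      then obtain c where c: "c \<in> S" "x < c" "c < y" by auto
      have "S \<inter> {x<..<c} \<subset> S \<inter> {x<..<y}" "S \<inter> {c<..<y} \<subset> S \<inter> {x<..<y}"
        using c by auto
      then have "card (S \<inter> {x<..<c}) < card (S \<inter> {x<..<y})"
        "card (S \<inter> {c<..<y}) < card (S \<inter> {x<..<y})"
        using \<open>finite S\<close> by (auto intro: psubset_card_mono)
      with less.hyps[of x c] less.hyps[of c y] c show ?thesis by simp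
    qed
  qed
qed

text \<open>Strict contraction along f means that \<open>\<Phi>\<close> + c * (\<open>\<Phi>\<close>
  o f) is strictly increasing for c = 1 and c = -1. Its derivative is positive off a finite set by
  \<open>plus\<close> and \<open>minus\<close>. \<open>S\<close> holds the junctions of the density,
  \<open>T\<close> further points where strictness may fail.\<close>

lemma suitable_of_density:
  fixes \<Phi> \<rho> :: "real \<Rightarrow> real"
  assumes "a > 0" and fin: "finite S" "finite T"
    and cont: "continuous_on UNIV \<Phi>"
    and lim: "(\<Phi> \<longlongrightarrow> U) at_top" "(\<Phi> \<longlongrightarrow> L) at_bot"
    and der: "\<And>x. x \<notin> S \<Longrightarrow> (\<Phi> has_real_derivative \<rho> x) (at x)"
    and pos: "\<And>x. x \<notin> S \<Longrightarrow> \<rho> x > 0"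
    and plus: "\<And>x. x \<notin> S \<Longrightarrow> x \<notin> T \<Longrightarrow> exp (a * x) \<notin> S \<Longrightarrow>
      \<rho> (exp (a * x)) * (a * exp (a * x)) < \<rho> x"
    and minus: "\<And>x. x \<notin> S \<Longrightarrow> x \<notin> T \<Longrightarrow> - exp (a * x) \<notin> S \<Longrightarrow>
      \<rho> (- exp (a * x)) * (a * exp (a * x)) < \<rho> x"
  shows "suitable a"
proof -
  define \<Psi> where "\<Psi> x = (case x of ereal r \<Rightarrow> \<Phi> r | PInfty \<Rightarrow> U | MInfty \<Rightarrow> L)" for x
  have \<Psi>: "\<Psi> (ereal r) = \<Phi> r" for r by (simp add: \<Psi>_def)
  have c\<Psi>: "continuous_on UNIV \<Psi>"
    by (rule continuous_on_ereal_extension[OF cont lim])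
      (auto simp: \<Psi>_def simp flip: PInfty_eq_infinity MInfty_eq_minfinity)
  have mono: "strict_mono \<Psi>"
  proof (rule strict_mono_ereal_extension[OF c\<Psi>])
    show "strict_mono (\<lambda>r. \<Psi> (ereal r))" unfolding \<Psi>
      by (rule strict_mono_of_deriv_pos_except_finite[OF fin(1) cont]) (use der pos in blast)
  qed
  define e where "e s r = (case s of PlusSign \<Rightarrow> exp (a * r) | MinusSign \<Rightarrow> - exp (a * r))" for s r
  have e: "sign_fun a s (ereal r) = ereal (e s r)" for s r
    by (cases s) (auto simp: sign_fun_def e_def)
  have e': "(e s has_real_derivative a * e s x) (at x)" for s x
    unfolding e_def by (cases s) (auto intro!: derivative_eq_intros)
  have inj: "inj (e s)" for s
    using \<open>a > 0\<close> by (cases s) (auto simp: inj_def e_def)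
  have ce: "continuous_on UNIV (e s)" for s
    by (meson DERIV_isCont continuous_at_imp_continuous_on e')
  have small: "\<rho> (e s x) * \<bar>a * e s x\<bar> < \<rho> x"
    if "x \<notin> S" "x \<notin> T" "e s x \<notin> S" for s x
    using that plus[of x] minus[of x] \<open>a > 0\<close> by (cases s) (auto simp: e_def abs_mult)
  have contr_mono: "strict_mono (\<lambda>x. \<Psi> x + c * \<Psi> (sign_fun a s x))"
    if c: "\<bar>c\<bar> = 1" for c s
  proof (rule strict_mono_ereal_extension)
    show "continuous_on UNIV (\<lambda>x. \<Psi> x + c * \<Psi> (sign_fun a s x))"
      by (intro continuous_intros c\<Psi> continuous_on_compose2[OF c\<Psi> continuous_on_sign_fun] \<open>a > 0\<close>) auto
    \<comment> \<open>The chain rule must also avoid the points that \<open>e s\<close> sends into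
      \<open>S\<close>; they are finitely many because \<open>e s\<close> is injective.\<close>
    let ?V = "S \<union> T \<union> e s -` S"
    have V: "finite ?V" using fin by (auto intro: finite_vimageI inj)
    have "strict_mono (\<lambda>r. \<Phi> r + c * \<Phi> (e s r))"
    proof (rule strict_mono_of_deriv_pos_except_finite[OF V])
      show "continuous_on UNIV (\<lambda>r. \<Phi> r + c * \<Phi> (e s r))"
        by (intro continuous_intros cont continuous_on_compose2[OF cont ce]) auto
      fix x assume x: "x \<notin> ?V"
      have "((\<lambda>r. \<Phi> (e s r)) has_real_derivative \<rho> (e s x) * (a * e s x)) (at x)"
        using x der[of "e s x"] e'[of s x] by (auto intro: DERIV_chain2)
      then have D: "((\<lambda>r. \<Phi> r + c * \<Phi> (e s r)) has_real_derivative
          \<rho> x + c * (\<rho> (e s x) * (a * e s x))) (at x)"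
        using x der[of x] by (auto intro!: derivative_intros DERIV_cmult)
      have "\<bar>c * (\<rho> (e s x) * (a * e s x))\<bar> < \<rho> x"
        using small[of x s] x c pos[of "e s x"] by (simp add: abs_mult)
      then have "\<rho> x + c * (\<rho> (e s x) * (a * e s x)) > 0" by linarith
      with D show "\<exists>D. ((\<lambda>r. \<Phi> r + c * \<Phi> (e s r)) has_real_derivative D) (at x) \<and> D > 0"
        by blast
    qed
    then show "strict_mono (\<lambda>r. \<Psi> (ereal r) + c * \<Psi> (sign_fun a s (ereal r)))"
      by (simp add: e \<Psi>)
  qed
  have contr: "\<bar>\<Psi> (sign_fun a s x) - \<Psi> (sign_fun a s y)\<bar> < \<Psi> y - \<Psi> x" if "x < y" for s x y
    using strict_monoD[OF contr_mono[of 1 s] that] strict_monoD[OF contr_mono[of "-1" s] that]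
    by simp
  show ?thesis
  proof (rule suitable_of_contraction[OF \<open>a > 0\<close> c\<Psi> mono continuous_on_sign_fun[OF \<open>a > 0\<close>]])
    fix s and x y :: ereal assume "x \<noteq> y"
    then show "\<bar>\<Psi> (sign_fun a s x) - \<Psi> (sign_fun a s y)\<bar> < \<bar>\<Psi> x - \<Psi> y\<bar>"
      using contr[of x y s] contr[of y x s] by (cases x y rule: linorder_cases) auto
  qed
qed

subsection \<open>Contracting densities\<close>

text \<open>The left side is the tangent of \<open>exp\<close> at 1.\<close>

lemma exp_ge_exp1_mult: "exp 1 * x \<le> exp (x::real)"
  using exp_ge_add_one_self[of "x - 1"] by (simp add: exp_diff field_simps)

lemma one_add_less_exp:
  assumes "x \<noteq> 0"
  shows "1 + x < exp (x::real)"
proof -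
  have "1 + x \<noteq> exp x" using ln_eq_minus_one[of "exp x"] assms by auto
  then show ?thesis using exp_ge_add_one_self[of x] by (simp add: less_le)
qed

text \<open>Square x < exp (x / 2), which follows from the tangent bound at x / 2 and 2 < e.\<close>

lemma exp_gt_square:
  assumes "0 \<le> (x::real)"
  shows "x\<^sup>2 < exp x"
proof -
  have "x < exp (x / 2)"
  proof (cases "x = 0")
    case False
    have "2 < exp (1::real)" using one_add_less_exp[of 1] by simp
    then have "x < exp 1 * (x / 2)" using False assms by simp
    also have "\<dots> \<le> exp (x / 2)" by (rule exp_ge_exp1_mult)
    finally show ?thesis .
  qed simp
  then have "x * x < exp (x / 2) * exp (x / 2)"
    using assms by (intro mult_strict_mono') auto
  then show ?thesis by (simp add: power2_eq_square flip: exp_add)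
qed

text \<open>The bound \<open>1 \<le> a\<close> serves the range x > 1, and
  \<open>a \<le> exp 1\<close> the range -1 < x < 0. There the requirement becomes - a^2 * x * exp
  (a * x) < 1, whose left side is at most a / e, attained at x = -1 / a.\<close>

lemma suitable_of_ge_1:
  assumes "1 \<le> a" "a \<le> exp 1"
  shows "suitable a"
proof -
  \<comment> \<open>Each summand is a primitive on one piece and is clamped to a constant elsewhere,
    so continuity at the junctions comes termwise.\<close>
  define \<Phi> where "\<Phi> x = ln (1 + a * max 0 (min x 1)) / a - ln (1 - a * min 0 (max x (-1))) / a
    - 1 / (a * max x 1) + exp (a * min x (-1))" for x
  define \<rho> where "\<rho> x = (if x < -1 then a * exp (a * x) else if x \<le> 1 then 1 / (1 + a * \<bar>x\<bar>)
    else 1 / (a * x\<^sup>2))" for x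
  have a: "a > 0" using assms by simp
  have sq: "a * x\<^sup>2 < exp (a * x)" if "x > 0" for x
  proof -
    have "a * x\<^sup>2 \<le> (a * x)\<^sup>2"
      using assms mult_right_mono[of 1 a "a * x\<^sup>2"] by (simp add: power2_eq_square mult_ac)
    also have "\<dots> < exp (a * x)" using a that by (intro exp_gt_square) simp
    finally show ?thesis .
  qed
  have small: "\<rho> (s * exp (a * x)) * (a * exp (a * x)) < \<rho> x"
    if "x \<noteq> 0" "x \<noteq> -1" "x \<noteq> 1" "x \<noteq> -1 / a" "\<bar>s\<bar> = 1" for x s
  proof -
    define u where "u = exp (a * x)"
    have u: "u > 0" by (simp add: u_def)
    \<comment> \<open>For u > 1 the pulled-back density is at most 1 / u: exactly 1 / u on the
      right, and smaller on the left by (a u)^2 < exp (a u). With 1 / c the density at x, only c < u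
      remains to be checked.\<close>
    have far: "\<rho> (s * u) * (a * u) < 1 / c" if "0 < c" "c < u" "1 < u" for c
    proof -
      have "s = 1 \<or> s = -1" using \<open>\<bar>s\<bar> = 1\<close> by linarith
      then show ?thesis
      proof
        assume "s = 1"
        then have "\<rho> (s * u) * (a * u) = 1 / u"
          using \<open>1 < u\<close> a by (simp add: \<rho>_def power2_eq_square)
        also have "\<dots> < 1 / c"
          using that by (intro divide_strict_left_mono) auto
        finally show ?thesis .
      next
        assume "s = -1"
        then have "\<rho> (s * u) * (a * u) = a\<^sup>2 * u / exp (a * u)"
          using \<open>1 < u\<close> by (simp add: \<rho>_def power2_eq_square exp_minus divide_inverse)
        also have "\<dots> < a\<^sup>2 * u / (a * u)\<^sup>2"
          using a u exp_gt_square[of "a * u"] by (intro divide_strict_left_mono) auto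
        also have "\<dots> = 1 / u"
          using a u by (simp add: power2_eq_square)
        also have "\<dots> < 1 / c"
          using that by (intro divide_strict_left_mono) auto
        finally show ?thesis .
      qed
    qed
    consider "x < -1" | "-1 < x" "x < 0" | "0 < x" "x < 1" | "1 < x"
      using \<open>x \<noteq> 0\<close> \<open>x \<noteq> -1\<close> \<open>x \<noteq> 1\<close> by linarith
    then have "\<rho> (s * u) * (a * u) < \<rho> x"
    proof cases
      case 1
      then have "u < 1" using a by (simp add: u_def mult_pos_neg)
      with u have "\<rho> (s * u) = 1 / (1 + a * u)"
        using \<open>\<bar>s\<bar> = 1\<close> by (auto simp: \<rho>_def abs_mult abs_if split: if_splits)
      then have "\<rho> (s * u) * (a * u) < a * u"
        using a u by (simp add: divide_less_eq)
      then show ?thesis using 1 by (simp add: \<rho>_def u_def)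
    next
      case 2
      then have "u < 1" using a by (simp add: u_def mult_pos_neg)
      with u have r: "\<rho> (s * u) = 1 / (1 + a * u)"
        using \<open>\<bar>s\<bar> = 1\<close> by (auto simp: \<rho>_def abs_mult abs_if split: if_splits)
      have "- a * x - 1 \<noteq> 0" using \<open>x \<noteq> -1 / a\<close> a by (auto simp: field_simps)
      then have "- a * x < exp (- a * x - 1)"
        using one_add_less_exp[of "- a * x - 1"] by simp
      then have "- a * x * u < exp (-1)"
        using u by (simp add: u_def exp_diff exp_minus field_simps)
      then have "a * (- a * x * u) < a * exp (-1)"
        using a by (rule mult_strict_left_mono)
      also have "\<dots> \<le> exp 1 * exp (-1)" using assms by simp
      also have "\<dots> = 1" by (simp flip: exp_add)
      finally have "a * u * (1 - a * x) < 1 + a * u" by (simp add: algebra_simps)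
      moreover have "1 - a * x > 0" using 2 a by (simp add: mult_pos_neg less_trans[of _ 0])
      moreover have "1 + a * u > 0" using a u by (simp add: add_pos_pos)
      ultimately have "1 / (1 + a * u) * (a * u) < 1 / (1 - a * x)"
        by (simp add: field_simps)
      moreover have "\<rho> x = 1 / (1 - a * x)" using 2 by (simp add: \<rho>_def)
      ultimately show ?thesis using r by simp
    next
      case 3
      have "1 + a * x < u" using one_add_less_exp[of "a * x"] 3 a by (simp add: u_def)
      moreover have "a * x > 0" using a 3 by simp
      ultimately have "\<rho> (s * u) * (a * u) < 1 / (1 + a * x)" by (intro far) auto
      then show ?thesis using 3 by (simp add: \<rho>_def)
    next
      case 4
      have "\<rho> (s * u) * (a * u) < 1 / (a * x\<^sup>2)"
        using sq[of x] 4 a by (intro far) (auto simp: u_def)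
      then show ?thesis using 4 by (simp add: \<rho>_def)
    qed
    then show ?thesis by (simp add: u_def)
  qed
  show ?thesis
  \<comment> \<open>The pieces of the density meet at -1, 0 and 1; at -1 / a strictness is lost when
    a = e.\<close>
  proof (rule suitable_of_density[of a "{-1, 0, 1}" "{-1 / a}" \<Phi> _ _ \<rho>])
    show "continuous_on UNIV \<Phi>" unfolding \<Phi>_def
    proof (intro continuous_intros ballI)
      fix x
      have "a * max 0 (min x 1) \<ge> 0" using a by simp
      then show "1 + a * max 0 (min x 1) \<noteq> 0" by linarith
      have "a * min 0 (max x (-1)) \<le> 0" using a by (simp add: mult_nonneg_nonpos)
      then show "1 - a * min 0 (max x (-1)) \<noteq> 0" by linarith
      show "a * max x 1 \<noteq> 0" using a by (auto simp: max_def)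
    qed (use a in auto)
    show "(\<Phi> \<longlongrightarrow> ln (1 + a) / a + exp (- a)) at_top"
    proof (rule Lim_transform_eventually)
      show "((\<lambda>x. ln (1 + a) / a - 1 / (a * x) + exp (- a)) \<longlongrightarrow> ln (1 + a) / a + exp (- a)) at_top"
        using a by real_asymp
      show "\<forall>\<^sub>F x in at_top. ln (1 + a) / a - 1 / (a * x) + exp (- a) = \<Phi> x"
        using eventually_ge_at_top[of 1] by eventually_elim (simp add: \<Phi>_def)
    qed
    show "(\<Phi> \<longlongrightarrow> - ln (1 + a) / a - 1 / a) at_bot"
    proof (rule Lim_transform_eventually)
      show "((\<lambda>x. - ln (1 + a) / a - 1 / a + exp (a * x)) \<longlongrightarrow> - ln (1 + a) / a - 1 / a) at_bot"
        using a by real_asymp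
      show "\<forall>\<^sub>F x in at_bot. - ln (1 + a) / a - 1 / a + exp (a * x) = \<Phi> x"
        using eventually_le_at_bot[of "-1"] by eventually_elim (simp add: \<Phi>_def)
    qed
    show "\<rho> x > 0" for x
      using a by (auto simp: \<rho>_def add_pos_nonneg)
    show "(\<Phi> has_real_derivative \<rho> x) (at x)" if x: "x \<notin> {-1, 0, 1}" for x
    proof -
      consider "x < -1" | "-1 < x" "x < 0" | "0 < x" "x < 1" | "1 < x"
        using x by fastforce
      then show ?thesis
      proof cases
        case 1
        have "((\<lambda>x. - ln (1 + a) / a - 1 / a + exp (a * x)) has_real_derivative \<rho> x) (at x)"
          using 1 by (auto intro!: derivative_eq_intros simp: \<rho>_def)
        then show ?thesis
          by (rule has_field_derivative_transform_within_open[where S = "{..<-1}"])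
            (use 1 in \<open>auto simp: \<Phi>_def\<close>)
      next
        case 2
        have "1 - a * x > 0" using 2 a by (simp add: mult_pos_neg less_trans[of _ 0])
        then have "((\<lambda>x. - ln (1 - a * x) / a - 1 / a + exp (- a)) has_real_derivative \<rho> x) (at x)"
          using 2 a by (auto intro!: derivative_eq_intros simp: \<rho>_def)
        then show ?thesis
          by (rule has_field_derivative_transform_within_open[where S = "{-1<..<0}"])
            (use 2 in \<open>auto simp: \<Phi>_def\<close>)
      next
        case 3
        have "1 + a * x > 0" using 3 a by (simp add: add_pos_pos)
        then have "((\<lambda>x. ln (1 + a * x) / a - 1 / a + exp (- a)) has_real_derivative \<rho> x) (at x)"
          using 3 a by (auto intro!: derivative_eq_intros simp: \<rho>_def)
        then show ?thesis
          by (rule has_field_derivative_transform_within_open[where S = "{0<..<1}"])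
            (use 3 in \<open>auto simp: \<Phi>_def\<close>)
      next
        case 4
        have "((\<lambda>x. ln (1 + a) / a - 1 / (a * x) + exp (- a)) has_real_derivative \<rho> x) (at x)"
          using 4 a by (auto intro!: derivative_eq_intros simp: \<rho>_def power2_eq_square)
        then show ?thesis
          by (rule has_field_derivative_transform_within_open[where S = "{1<..}"])
            (use 4 in \<open>auto simp: \<Phi>_def\<close>)
      qed
    qed
    show "\<rho> (exp (a * x)) * (a * exp (a * x)) < \<rho> x" if "x \<notin> {-1, 0, 1}" "x \<notin> {-1 / a}" for x
      using small[of x 1] that by simp
    show "\<rho> (- exp (a * x)) * (a * exp (a * x)) < \<rho> x" if "x \<notin> {-1, 0, 1}" "x \<notin> {-1 / a}" for x
      using small[of x "-1"] that by simp
  qed (use a in auto)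
qed

text \<open>On \<open>x > 1 / a\<close> the density has to decay like \<open>x powr (- 1 - 1 / a)\<close>: contraction there
  along \<open>exp (a * x)\<close> amounts to \<open>a * x powr (1 + 1 / a) < exp x\<close>. The factor \<open>K > 1\<close> makes
  \<open>exp (a * x)\<close> contract strictly, instead of isometrically, from the negative reals to \<open>{0<..1}\<close>.\<close>

lemma suitable_of_powr_bound:
  assumes "0 < a" "a < 1" "1 < K" "K \<le> 2"
    and bound: "\<And>w. 0 < w \<Longrightarrow> K * a * w powr (1 + 1 / a) \<le> exp w"
  shows "suitable a"
proof -
  \<comment> \<open>Again a sum of clamped primitives, for the negative reals, [0, 1/a] and the
    range beyond 1/a.\<close>
  define \<Phi> where "\<Phi> x = K * exp (a * min x 0) + max 0 (min x (1 / a))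
    - (a * max x (1 / a)) powr (- 1 / a)" for x
  define \<rho> where "\<rho> x = (if x < 0 then K * a * exp (a * x) else if x \<le> 1 / a then 1
    else (a * x) powr (- 1 / a - 1))" for x
  have x1: "x < 1 / a \<longleftrightarrow> a * x < 1" "1 / a < x \<longleftrightarrow> 1 < a * x" "x \<le> 1 / a \<longleftrightarrow> a * x \<le> 1" for x
    using \<open>0 < a\<close> by (auto simp: field_simps)
  \<comment> \<open>This is \<open>bound\<close> at \<open>x\<close>, weakened by dropping
    \<open>K > 1\<close> and multiplied by \<open>a powr (1 / a)\<close>. It is the contraction
    along \<open>exp (a * x)\<close> beyond 1/a.\<close>
  have key: "(a * x) powr (1 + 1 / a) < (a * exp (a * x)) powr (1 / a)" if "x > 0" for x
  proof -
    have "a * x powr (1 + 1 / a) < K * a * x powr (1 + 1 / a)"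
      using \<open>1 < K\<close> \<open>0 < a\<close> that by simp
    also have "\<dots> \<le> exp x" by (rule bound[OF that])
    finally have "a * x powr (1 + 1 / a) < exp x" .
    then have "a powr (1 / a) * (a * x powr (1 + 1 / a)) < a powr (1 / a) * exp x"
      using \<open>0 < a\<close> by simp
    moreover have "(a * x) powr (1 + 1 / a) = a powr (1 / a) * (a * x powr (1 + 1 / a))"
      using \<open>0 < a\<close> that by (simp add: powr_mult powr_add)
    moreover have "(a * exp (a * x)) powr (1 / a) = a powr (1 / a) * exp x"
      using \<open>0 < a\<close> by (simp add: powr_def ln_mult add_divide_distrib exp_add)
    ultimately show ?thesis by simp
  qed
  have neg_powr: "(a * x) powr (- 1 / a - 1) = 1 / (a * x) powr (1 + 1 / a)" for x
  proof -
    have "- 1 / a - 1 = - (1 + 1 / a)" by simp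
    then show ?thesis by (simp only: powr_minus_divide)
  qed
  have plus: "\<rho> (exp (a * x)) * (a * exp (a * x)) < \<rho> x"
    if "x \<noteq> 0" "exp (a * x) \<noteq> 1 / a" for x
  proof -
    define u where "u = exp (a * x)"
    have u: "u > 0" by (simp add: u_def)
    \<comment> \<open>At a * u = 1 the pulled-back density would equal 1, the density on [0, 1/a];
      there the image is a junction.\<close>
    have au: "a * u \<noteq> 1" using that \<open>0 < a\<close> by (auto simp: u_def field_simps)
    have ge: "\<rho> u * (a * u) = (a * u) powr (- 1 / a)" if "a * u > 1"
    proof -
      have "\<rho> u = (a * u) powr (- 1 / a - 1)" using that u by (simp add: \<rho>_def x1)
      then show ?thesis
        using that powr_add[of "a * u" "- 1 / a - 1" 1] by simp
    qed
    have le: "\<rho> u * (a * u) = a * u" if "a * u \<le> 1"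
      using that u by (simp add: \<rho>_def x1)
    consider "x < 0" | "0 < x" "a * x \<le> 1" | "0 < x" "1 < a * x" using \<open>x \<noteq> 0\<close> by linarith
    then have "\<rho> u * (a * u) < \<rho> x"
    proof cases
      case 1
      then have "u < 1" using \<open>0 < a\<close> by (simp add: u_def mult_pos_neg)
      then have "a * u \<le> 1" using \<open>0 < a\<close> \<open>a < 1\<close> u by (intro mult_le_one) auto
      then have "\<rho> u * (a * u) = a * u" by (rule le)
      also have "\<dots> < K * (a * u)" using \<open>1 < K\<close> \<open>0 < a\<close> u by simp
      also have "\<dots> = \<rho> x" using 1 by (simp add: \<rho>_def u_def)
      finally show ?thesis .
    next
      case 2
      then have "\<rho> x = 1" by (simp add: \<rho>_def x1)
      moreover have "(a * u) powr (- 1 / a) < 1" if "a * u > 1"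
        using that \<open>0 < a\<close> powr_less_mono[of "- 1 / a" 0 "a * u"] u by simp
      ultimately show ?thesis using ge le au by (cases "a * u > 1") auto
    next
      case 3
      have k: "(a * x) powr (1 + 1 / a) < (a * u) powr (1 / a)"
        using key[of x] 3 by (simp add: u_def)
      moreover have "1 < (a * x) powr (1 + 1 / a)"
        using 3 \<open>0 < a\<close> powr_less_mono[of 0 "1 + 1 / a" "a * x"] by (simp add: add_pos_pos)
      ultimately have "1 < (a * u) powr (1 / a)" by simp
      then have "a * u > 1"
        using powr_le1[of "1 / a" "a * u"] \<open>0 < a\<close> u by (cases "a * u \<le> 1") auto
      then have "\<rho> u * (a * u) = 1 / (a * u) powr (1 / a)"
        using ge powr_minus_divide[of "a * u" "1 / a"] by simp
      also have "\<dots> < 1 / (a * x) powr (1 + 1 / a)"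
        using k 3 u \<open>0 < a\<close> by (intro divide_strict_left_mono) auto
      also have "\<dots> = \<rho> x" using 3 \<open>0 < a\<close> by (simp add: \<rho>_def x1 flip: neg_powr)
      finally show ?thesis .
    qed
    then show ?thesis by (simp add: u_def)
  qed
  have minus: "\<rho> (- exp (a * x)) * (a * exp (a * x)) < \<rho> x" if "x \<noteq> 0" for x
  proof -
    define w where "w = a * exp (a * x)"
    have w: "w > 0" using \<open>0 < a\<close> by (simp add: w_def)
    have r: "\<rho> (- exp (a * x)) = K * a * exp (- w)"
      by (simp add: \<rho>_def w_def)
    consider "x < 0" | "0 < x" "a * x \<le> 1" | "0 < x" "1 < a * x" using \<open>x \<noteq> 0\<close> by linarith
    then have "K * a * exp (- w) * w < \<rho> x"
    proof cases
      case 1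
      have "a * exp (- w) < 1 * 1" using \<open>0 < a\<close> \<open>a < 1\<close> w by (intro mult_strict_mono) auto
      then have "K * w * (a * exp (- w)) < K * w * 1"
        using \<open>1 < K\<close> w by (intro mult_strict_left_mono) auto
      then show ?thesis using 1 by (simp add: \<rho>_def w_def mult_ac)
    next
      case 2
      \<comment> \<open>Here the density at x is 1, so w * exp (- w) < 1/2 together with K * a \<le>
        2 suffices; this is where \<open>K \<le> 2\<close> enters.\<close>
      have "w * exp (- w) \<le> exp (-1)"
        using exp_ge_exp1_mult[of w] by (simp add: exp_minus field_simps)
      also have "\<dots> < 1 / 2"
        using one_add_less_exp[of 1] by (simp add: exp_minus field_simps)
      finally have "(K * a) * (w * exp (- w)) < (K * a) * (1 / 2)"
        using \<open>1 < K\<close> \<open>0 < a\<close> by (intro mult_strict_left_mono) auto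
      also have "\<dots> \<le> (2 * 1) * (1 / 2)"
        using \<open>K \<le> 2\<close> \<open>a < 1\<close> \<open>0 < a\<close> \<open>1 < K\<close> by (intro mult_right_mono mult_mono) auto
      finally show ?thesis using 2 by (simp add: \<rho>_def x1 mult_ac)
    next
      case 3
      \<comment> \<open>The hypothesis \<open>bound\<close> acts twice: at \<open>x\<close> through
        \<open>key\<close>, then at \<open>w\<close>.\<close>
      have "(a * x) powr (1 + 1 / a) * (K * a * w) < w powr (1 / a) * (K * a * w)"
        using key[of x] 3 \<open>0 < a\<close> \<open>1 < K\<close> w by (intro mult_strict_right_mono) (auto simp: w_def)
      also have "\<dots> = K * a * w powr (1 + 1 / a)"
        using w by (simp add: powr_add)
      also have "\<dots> \<le> exp w" by (rule bound[OF w])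
      finally have "K * a * exp (- w) * w * (a * x) powr (1 + 1 / a) < 1"
        by (simp add: exp_minus field_simps)
      moreover have "(a * x) powr (1 + 1 / a) > 0" using 3 \<open>0 < a\<close> by simp
      ultimately have "K * a * exp (- w) * w < 1 / (a * x) powr (1 + 1 / a)"
        by (simp only: pos_less_divide_eq)
      also have "\<dots> = \<rho> x" using 3 \<open>0 < a\<close> by (simp add: \<rho>_def x1 flip: neg_powr)
      finally show ?thesis .
    qed
    then show ?thesis unfolding r by (simp add: w_def)
  qed
  show ?thesis
  proof (rule suitable_of_density[of a "{0, 1 / a}" "{}" \<Phi> _ _ \<rho>])
    show "continuous_on UNIV \<Phi>" unfolding \<Phi>_def
      using \<open>0 < a\<close> by (intro continuous_intros) (auto simp: max_def)
    show "(\<Phi> \<longlongrightarrow> K + 1 / a) at_top"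
    proof (rule Lim_transform_eventually)
      show "((\<lambda>x. K + 1 / a - (a * x) powr (- 1 / a)) \<longlongrightarrow> K + 1 / a) at_top"
        using \<open>0 < a\<close> by real_asymp
      show "\<forall>\<^sub>F x in at_top. K + 1 / a - (a * x) powr (- 1 / a) = \<Phi> x"
        using eventually_ge_at_top[of "1 / a"] eventually_ge_at_top[of 0]
        by eventually_elim (use \<open>0 < a\<close> in \<open>simp add: \<Phi>_def\<close>)
    qed
    show "(\<Phi> \<longlongrightarrow> - 1) at_bot"
    proof (rule Lim_transform_eventually)
      show "((\<lambda>x. K * exp (a * x) - 1) \<longlongrightarrow> - 1) at_bot"
        using \<open>0 < a\<close> by real_asymp
      show "\<forall>\<^sub>F x in at_bot. K * exp (a * x) - 1 = \<Phi> x"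
        using eventually_le_at_bot[of 0]
      proof eventually_elim
        case (elim x)
        have "x \<le> 1 / a" using elim \<open>0 < a\<close> by (simp add: order_trans[of _ 0])
        then show ?case using elim \<open>0 < a\<close> by (simp add: \<Phi>_def)
      qed
    qed
    show "\<rho> x > 0" for x
      using \<open>0 < a\<close> \<open>1 < K\<close> by (auto simp: \<rho>_def)
    show "(\<Phi> has_real_derivative \<rho> x) (at x)" if x: "x \<notin> {0, 1 / a}" for x
    proof -
      have "1 / a > 0" using \<open>0 < a\<close> by simp
      then have neg: "z \<le> 1 / a" if "z < 0" for z using that by linarith
      consider "x < 0" | "0 < x" "x < 1 / a" | "1 / a < x" using x by fastforce
      then show ?thesis
      proof cases
        case 1
        have "((\<lambda>x. K * exp (a * x) - 1) has_real_derivative \<rho> x) (at x)"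
          using 1 by (auto intro!: derivative_eq_intros simp: \<rho>_def)
        then show ?thesis
          by (rule has_field_derivative_transform_within_open[where S = "{..<0}"])
            (use 1 neg \<open>0 < a\<close> in \<open>auto simp: \<Phi>_def\<close>)
      next
        case 2
        have "((\<lambda>x. K + x - 1) has_real_derivative \<rho> x) (at x)"
          using 2 by (auto intro!: derivative_eq_intros simp: \<rho>_def)
        then show ?thesis
          by (rule has_field_derivative_transform_within_open[where S = "{0<..<1 / a}"])
            (use 2 \<open>0 < a\<close> in \<open>auto simp: \<Phi>_def max_def min_def\<close>)
      next
        case 3
        have pos: "0 < z" if "1 / a < z" for z using that \<open>1 / a > 0\<close> by linarith
        have "0 < x" using pos 3 by simp
        then have "((\<lambda>x. K + 1 / a - (a * x) powr (- 1 / a)) has_real_derivative \<rho> x) (at x)"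
          using 3 \<open>0 < a\<close> by (auto intro!: derivative_eq_intros simp: \<rho>_def)
        then show ?thesis
          by (rule has_field_derivative_transform_within_open[where S = "{1 / a<..}"])
            (use 3 \<open>0 < a\<close> in \<open>auto simp: \<Phi>_def max_def min_def dest: pos\<close>)
      qed
    qed
    show "\<rho> (exp (a * x)) * (a * exp (a * x)) < \<rho> x"
      if "x \<notin> {0, 1 / a}" "exp (a * x) \<notin> {0, 1 / a}" for x
      using plus[of x] that by simp
    show "\<rho> (- exp (a * x)) * (a * exp (a * x)) < \<rho> x" if "x \<notin> {0, 1 / a}" for x
      using minus[of x] that by simp
  qed (use \<open>0 < a\<close> in auto)
qed

subsection \<open>The threshold\<close>

text \<open>The maximum of \<open>w powr r * exp (- w)\<close> is at w = r; the bound is y \<le> exp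
  (y - 1) at y = w / r, raised to the power r.\<close>

lemma powr_le_exp:
  assumes "0 < r" "0 < (w::real)"
  shows "w powr r \<le> (r / exp 1) powr r * exp w"
proof -
  have "w / r \<le> exp (w / r - 1)" using exp_ge_add_one_self[of "w / r - 1"] by simp
  then have "(w / r) powr r \<le> exp (w / r - 1) powr r"
    using assms by (intro powr_mono2) auto
  also have "\<dots> = exp (w - r)"
    using assms by (simp add: powr_def algebra_simps)
  finally show ?thesis
    using assms by (simp add: powr_def ln_div exp_diff exp_minus right_diff_distrib field_simps)
qed

text \<open>For x > 0, the logarithm of the left side of the threshold equation.\<close>

definition log_threshold :: "real \<Rightarrow> real" where
  "log_threshold x = ln (x + 1) - ln x / (x + 1)"

lemma is_threshold_iff: "is_threshold x \<longleftrightarrow> 0 < x \<and> x < 1 \<and> log_threshold x = 1"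
proof -
  have "(x + 1) * x powr (- 1 / (x + 1)) = exp (log_threshold x)" if "0 < x"
    using that by (simp add: log_threshold_def powr_def exp_diff exp_minus divide_inverse)
  then show ?thesis unfolding is_threshold_def by auto
qed

text \<open>On (0, 1) both 1 / z > 1 and ln z < 0 push the subtracted part of the derivative above 1
  / (z + 1).\<close>

lemma log_threshold_strict_antimono:
  assumes "0 < x" "x < y" "y \<le> 1"
  shows "log_threshold y < log_threshold x"
proof (rule DERIV_neg_imp_decreasing_open[OF \<open>x < y\<close>])
  have der: "(log_threshold has_real_derivative 1 / (z + 1) - (1 / z * (z + 1) - ln z) / ((z + 1) * (z + 1))) (at z)"
    if "0 < z" for z
    unfolding log_threshold_def[abs_def] using that
    by (auto intro!: derivative_eq_intros)
  show "\<exists>D. (log_threshold has_real_derivative D) (at z) \<and> D < 0" if "x < z" "z < y" for z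
  proof (intro exI conjI)
    show "(log_threshold has_real_derivative
        1 / (z + 1) - (1 / z * (z + 1) - ln z) / ((z + 1) * (z + 1))) (at z)"
      using that assms by (intro der) simp
    have "1 * (z + 1) < 1 / z * (z + 1) - ln z"
    proof -
      have "1 * (z + 1) < 1 / z * (z + 1)"
        using that assms by (intro mult_strict_right_mono) auto
      moreover have "ln z < 0" using that assms by simp
      ultimately show ?thesis by linarith
    qed
    then have "1 * (z + 1) / ((z + 1) * (z + 1)) < (1 / z * (z + 1) - ln z) / ((z + 1) * (z + 1))"
      using that assms by (intro divide_strict_right_mono) auto
    then show "1 / (z + 1) - (1 / z * (z + 1) - ln z) / ((z + 1) * (z + 1)) < 0"
      using that assms by simp
  qed
  show "continuous_on {x..y} log_threshold"
    using assms by (intro continuous_at_imp_continuous_on ballI DERIV_isCont[OF der]) auto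
qed

text \<open>Existence by the intermediate value theorem between 1/e and 1, where the values are
  above and below 1; uniqueness by strict monotonicity.\<close>

lemma ex1_is_threshold: "\<exists>!x. is_threshold x"
proof -
  have "continuous_on {exp (-1)..1} log_threshold"
    unfolding log_threshold_def[abs_def]
    by (intro continuous_intros ballI) (auto dest: less_le_trans[OF exp_gt_zero])
  moreover have "log_threshold 1 < 1"
    using ln_2_less_1 by (simp add: log_threshold_def)
  moreover have "1 < log_threshold (exp (-1))"
  proof -
    \<comment> \<open>Since ln (1/e) = -1, the value at 1/e is ln t + 1 / t, which exceeds 1 for t >
      1.\<close>
    define t :: real where "t = exp (-1) + 1"
    have "t > 1" by (simp add: t_def)
    then have "1 / t < exp (1 / t - 1)"
      using one_add_less_exp[of "1 / t - 1"] by simp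
    then have "ln (1 / t) < 1 / t - 1"
      using \<open>t > 1\<close> by (metis exp_ln_iff exp_less_cancel_iff less_trans zero_less_divide_1_iff zero_less_one)
    then show ?thesis using \<open>t > 1\<close> by (simp add: log_threshold_def ln_div flip: t_def)
  qed
  ultimately obtain x where x: "exp (-1) \<le> x" "x \<le> 1" "log_threshold x = 1"
    using IVT2'[of log_threshold 1 1 "exp (-1)"] by auto
  moreover have "0 < x" using x(1) exp_gt_zero[of "-1::real"] by linarith
  moreover have "x \<noteq> 1" using x \<open>log_threshold 1 < 1\<close> by auto
  ultimately have "is_threshold x" by (auto simp: is_threshold_iff)
  moreover have "y = x" if "is_threshold y" for y
    using that \<open>is_threshold x\<close> log_threshold_strict_antimono[of x y] log_threshold_strict_antimono[of y x]
    by (cases x y rule: linorder_cases) (auto simp: is_threshold_iff)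
  ultimately show ?thesis by blast
qed

text \<open>The logarithm of the maximum \<open>M\<close> factors as
  \<open>r * (log_threshold a - 1)\<close>, so \<open>M < 1\<close> because \<open>a\<close> lies
  beyond the threshold.\<close>

lemma suitable_of_threshold_less:
  assumes "threshold < a" "a < 1"
  shows "suitable a"
proof -
  have "is_threshold threshold"
    unfolding threshold_def by (rule theI'[OF ex1_is_threshold])
  then have t: "0 < threshold" "log_threshold threshold = 1" by (auto simp: is_threshold_iff)
  then have "0 < a" using assms by simp
  have L: "log_threshold a < 1"
    using log_threshold_strict_antimono[of threshold a] t assms by simp
  define r where "r = 1 + 1 / a"
  \<comment> \<open>\<open>M\<close> is the maximum of \<open>a * w powr (1 + 1 / a) * exp (- w)\<close>, attained at \<open>w = r\<close>.\<close>
  define M where "M = a * (r / exp 1) powr r"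
  have "r > 0" using \<open>0 < a\<close> by (simp add: r_def add_pos_pos)
  have "M > 0" using \<open>0 < a\<close> \<open>r > 0\<close> by (simp add: M_def)
  have r: "r = (a + 1) / a" using \<open>0 < a\<close> by (simp add: r_def field_simps)
  have "ln M = ln a + r * (ln r - 1)"
    using \<open>0 < a\<close> \<open>r > 0\<close> by (simp add: M_def ln_mult ln_powr ln_div)
  also have "\<dots> = r * (log_threshold a - 1)"
  proof -
    have "r * (ln a / (a + 1)) = ln a / a"
      using \<open>0 < a\<close> unfolding r by simp
    moreover have "r * ln a = ln a + ln a / a"
      by (simp add: r_def distrib_right)
    moreover have "ln r = ln (a + 1) - ln a" using \<open>0 < a\<close> by (simp add: r ln_div)
    ultimately show ?thesis by (simp add: log_threshold_def right_diff_distrib)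
  qed
  also have "\<dots> < 0" using L \<open>r > 0\<close> by (simp add: mult_pos_neg)
  finally have "M < 1" using \<open>M > 0\<close> by simp
  \<comment> \<open>This \<open>K\<close> uses part of the room left by \<open>M < 1\<close>: it
    exceeds 1 while K * M stays at most 1.\<close>
  have K: "1 < 2 / (1 + M)" "2 / (1 + M) \<le> 2" "2 / (1 + M) * M \<le> 1"
    using \<open>0 < M\<close> \<open>M < 1\<close> by (auto simp: field_simps)
  show ?thesis
  proof (rule suitable_of_powr_bound[OF \<open>0 < a\<close> \<open>a < 1\<close> K(1,2)])
    fix w :: real assume "0 < w"
    have "2 / (1 + M) * a * w powr r \<le> 2 / (1 + M) * a * ((r / exp 1) powr r * exp w)"
      using \<open>0 < M\<close> \<open>0 < a\<close> powr_le_exp[OF \<open>r > 0\<close> \<open>0 < w\<close>] by (intro mult_left_mono) auto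
    also have "\<dots> = (2 / (1 + M) * M) * exp w" by (simp add: M_def)
    also have "\<dots> \<le> 1 * exp w" using K(3) by (intro mult_right_mono) auto
    finally show "2 / (1 + M) * a * w powr (1 + 1 / a) \<le> exp w" by (simp add: r_def)
  qed
qed

theorem proposition4:
  shows "(\<exists>!x. is_threshold x)
    \<and> (\<forall>a::real. threshold < a \<and> a \<le> exp 1 \<longrightarrow> suitable a)
    \<and> suitable 1"
proof (intro conjI allI impI ex1_is_threshold)
  show "suitable a" if "threshold < a \<and> a \<le> exp 1" for a
    using that suitable_of_threshold_less[of a] suitable_of_ge_1[of a] by (cases "a < 1") auto
  show "suitable 1" by (rule suitable_of_ge_1) auto
qed

end
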